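(* Let $c<\log_2(e)$ be a real constant. There is no algorithm (i.e. no map) $\mathcal{A}$ that assigns to every instance $S$ of the minimum entropy coupling problem a distribution $\mathcal{A}_S$ that couples $S$, such that $$H(\mathcal{A}_S)\le H\left(\bigwedge S\right)+c\qquad\text{for all instances } S.$$
   Context: $H$ denotes Shannon entropy with logarithms in base $2$, i.e. $H(p)=\sum_i p(i)\log_2(1/p(i))$ with $0\log_2(1/0)=0$. The states of every distribution $p$ are indexed in non-increasing order, $p(1)\ge p(2)\ge\cdots$. An instance of the minimum entropy coupling problem is a set $S=\{p_1,\dots,p_m\}$ of $m$ probability distributions, each with $n$ states, where $m,n\ge1$ are arbitrary. A discrete (finite or countably infinite) distribution $C$ couples $S$ if it is the distribution of a variable having the elements of $S$ as its marginals; equivalently, for every $p\in S$ there is a map $f_p$ from the states of $C$ to $\{1,\dots,n\}$ such that $\sum_{k:\,f_p(k)=\ell}C(k)=p(\ell)$ for every $\ell\in\{1,\dots,n\}$. Majorization: $p\preceq q$ ($p$ is majorized by $q$) if $\sum_{j=1}^i p(j)\le\sum_{j=1}^i q(j)$ for all $i$. $\bigwedge S$ is the greatest lower bound of $S$ for $\preceq$; explicitly it is the distribution $\mathcal{M}_S$ on $n$ states with $\sum_{j=1}^i\mathcal{M}_S(j)=\min_{p\in S}\sum_{j=1}^i p(j)$ for every $i\in\{1,\dots,n\}$. *)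

theory Defs
  imports "HOL-Probability.Probability"
begin

text \<open>
  Shannon entropy in bits, with values in the extended reals: the terms are nonnegative (and
  \<^term>\<open>0\<close> at states of probability \<^term>\<open>0\<close>), so the sum always exists, and it is \<open>\<infinity>\<close> for a
  distribution of infinite entropy. A real-valued sum or Lebesgue integral would instead be
  \<^term>\<open>0\<close> there.
\<close>
definition shannon_entropy :: "'a pmf \<Rightarrow> ereal" where
  "shannon_entropy p =
     enn2ereal (\<integral>\<^sup>+ x. ennreal (pmf p x * log 2 (1 / pmf p x)) \<partial>count_space UNIV)"

text \<open>States are \<open>1, \<dots>, n\<close>, in order of non-increasing probability; probability \<^term>\<open>0\<close> is allowed.\<close>
definition n_state :: "nat \<Rightarrow> nat pmf \<Rightarrow> bool" where
  "n_state n p \<longleftrightarrow> set_pmf p \<subseteq> {1..n} \<and> antimono_on {1..n} (pmf p)"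

definition mec_instance :: "nat \<Rightarrow> nat pmf set \<Rightarrow> bool" where
  "mec_instance n S \<longleftrightarrow> n \<ge> 1 \<and> finite S \<and> S \<noteq> {} \<and> (\<forall>p\<in>S. n_state n p)"

text \<open>
  Finite and countably infinite distributions are both represented on the state space
  \<^typ>\<open>nat\<close>, with no ordering imposed on the states of \<open>C\<close>.
\<close>
definition couples :: "nat pmf \<Rightarrow> nat pmf set \<Rightarrow> bool" where
  "couples C S \<longleftrightarrow> (\<forall>p\<in>S. \<exists>f. map_pmf f C = p)"

definition majorized :: "nat pmf \<Rightarrow> nat pmf \<Rightarrow> bool" (infix "\<preceq>" 50) where
  "p \<preceq> q \<longleftrightarrow> (\<forall>i. (\<Sum>j=1..i. pmf p j) \<le> (\<Sum>j=1..i. pmf q j))"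

definition is_meet :: "nat \<Rightarrow> nat pmf set \<Rightarrow> nat pmf \<Rightarrow> bool" where
  "is_meet n S q \<longleftrightarrow> n_state n q \<and> (\<forall>p\<in>S. q \<preceq> p) \<and>
     (\<forall>r. n_state n r \<longrightarrow> (\<forall>p\<in>S. r \<preceq> p) \<longrightarrow> r \<preceq> q)"

text \<open>
  The greatest lower bound among the \<open>n\<close>-state distributions. It exists and is unique for every
  instance, and has the expected partial sums: see \<open>is_meet_meet\<close> and \<open>sum_meet\<close> below.
\<close>
definition meet :: "nat \<Rightarrow> nat pmf set \<Rightarrow> nat pmf" where
  "meet n S = (THE q. is_meet n S q)"

lemma n_state_pmf_zero:
  assumes "n_state n p" "j \<notin> {1..n}"
  shows "pmf p j = 0"
  using assms by (auto simp: n_state_def set_pmf_iff)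

lemma couples_iff:
  assumes "mec_instance n S"
  shows "couples C S \<longleftrightarrow>
    (\<forall>p\<in>S. \<exists>f. range f \<subseteq> {1..n} \<and> (\<forall>l\<in>{1..n}. (\<Sum>\<^sub>\<infinity>k\<in>{k. f k = l}. pmf C k) = pmf p l))"
proof -
  have pr: "(\<Sum>\<^sub>\<infinity>k\<in>{k. f k = l}. pmf C k) = pmf (map_pmf f C) l" for f :: "nat \<Rightarrow> nat" and l
  proof -
    have "pmf (map_pmf f C) l = measure_pmf.prob C {k. f k = l}"
      by (simp add: pmf_map vimage_def)
    also have "\<dots> = infsetsum (pmf C) {k. f k = l}"
      by (simp add: measure_pmf_conv_infsetsum)
    also have "\<dots> = (\<Sum>\<^sub>\<infinity>k\<in>{k. f k = l}. pmf C k)"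
      by (rule infsetsum_infsum) (rule pmf_abs_summable)
    finally show ?thesis by simp
  qed
  have "(\<exists>f. map_pmf f C = p) \<longleftrightarrow>
      (\<exists>f. range f \<subseteq> {1..n} \<and> (\<forall>l\<in>{1..n}. pmf (map_pmf f C) l = pmf p l))" if "p \<in> S" for p
  proof
    have p: "n_state n p" and n: "n \<ge> 1" using assms that by (auto simp: mec_instance_def)
    { assume "\<exists>f. map_pmf f C = p"
      then obtain f where f: "map_pmf f C = p" by blast
      define g where "g k = (if k \<in> set_pmf C then f k else 1)" for k
      have "map_pmf g C = p"
        unfolding f[symmetric] by (rule map_pmf_cong) (auto simp: g_def)
      moreover have "f k \<in> {1..n}" if "k \<in> set_pmf C" for k
        using p that unfolding n_state_def f[symmetric] by auto
      then have "range g \<subseteq> {1..n}" using n by (auto simp: g_def)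
      ultimately show "\<exists>f. range f \<subseteq> {1..n} \<and> (\<forall>l\<in>{1..n}. pmf (map_pmf f C) l = pmf p l)"
        by blast }
    { assume "\<exists>f. range f \<subseteq> {1..n} \<and> (\<forall>l\<in>{1..n}. pmf (map_pmf f C) l = pmf p l)"
      then obtain f where f: "range f \<subseteq> {1..n}" "\<forall>l\<in>{1..n}. pmf (map_pmf f C) l = pmf p l"
        by blast
      have "pmf (map_pmf f C) l = pmf p l" for l
      proof (cases "l \<in> {1..n}")
        case False
        then have "l \<notin> set_pmf (map_pmf f C)" using f(1) False by (auto simp: image_subset_iff)
        then have "pmf (map_pmf f C) l = 0" by (simp only: set_pmf_iff not_not)
        then show ?thesis using n_state_pmf_zero[OF p False] by simp
      qed (use f in auto)
      then show "\<exists>f. map_pmf f C = p" by (blast intro: pmf_eqI) }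
  qed
  then show ?thesis unfolding couples_def pr by blast
qed

lemma majorized_antisym:
  assumes "p \<preceq> q" "q \<preceq> p" "n_state n p" "n_state n q"
  shows "p = q"
proof (rule pmf_eqI)
  fix i :: nat
  have eq: "(\<Sum>j=1..i. pmf p j) = (\<Sum>j=1..i. pmf q j)" for i
    using assms(1,2) unfolding majorized_def by (meson antisym)
  show "pmf p i = pmf q i"
  proof (cases i)
    case 0
    then show ?thesis using assms(3,4) by (simp add: n_state_pmf_zero)
  next
    case (Suc k)
    then show ?thesis using eq[of k] eq[of i] by simp
  qed
qed

lemma is_meet_unique: "is_meet n S q \<Longrightarrow> is_meet n S q' \<Longrightarrow> q = q'"
  unfolding is_meet_def by (blast intro: majorized_antisym)

lemma sum_n_state:
  assumes "n_state n p" "n \<le> i"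
  shows "(\<Sum>j=1..i. pmf p j) = 1"
  using assms by (intro sum_pmf_eq_1) (auto simp: n_state_def)

lemma is_meetI:
  assumes "mec_instance n S" "n_state n q"
    and "\<And>i. (\<Sum>j=1..i. pmf q j) = (MIN p\<in>S. \<Sum>j=1..i. pmf p j)"
  shows "is_meet n S q"
  using assms unfolding is_meet_def majorized_def mec_instance_def by auto

lemma meet_exists:
  assumes "mec_instance n S"
  shows "\<exists>q. n_state n q \<and> (\<forall>i. (\<Sum>j=1..i. pmf q j) = (MIN p\<in>S. \<Sum>j=1..i. pmf p j))"
proof -
  have S: "finite S" "S \<noteq> {}" "\<And>p. p \<in> S \<Longrightarrow> n_state n p"
    using assms by (auto simp: mec_instance_def)
  define P where "P p i = (\<Sum>j=1..i. pmf p j)" for p :: "nat pmf" and i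
  define F where "F i = (MIN p\<in>S. P p i)" for i
  define g where "g i = (if i = 0 then 0 else F i - F (i - 1))" for i
  have F_le: "F i \<le> P p i" if "p \<in> S" for p i
    using that S by (auto simp: F_def)
  have F_att: "\<exists>p\<in>S. F i = P p i" for i
  proof -
    have "F i \<in> (\<lambda>p. P p i) ` S" unfolding F_def using S by (intro Min_in) auto
    then show ?thesis by auto
  qed
  have P_Suc: "P p (Suc i) = P p i + pmf p (Suc i)" for p i by (simp add: P_def)
  have F0: "F 0 = 0" using F_att[of 0] by (auto simp: P_def)
  have F1: "F i = 1" if "n \<le> i" for i
    using F_att[of i] that S(3) unfolding P_def by (metis sum_n_state)
  have g_nonneg: "0 \<le> g i" for i
  proof (cases i)
    case (Suc k)
    obtain p where p: "p \<in> S" "F i = P p i" using F_att by blast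
    have "F k \<le> P p k" using p(1) by (rule F_le)
    then show ?thesis using p Suc P_Suc[of p k] by (simp add: g_def add_increasing2)
  qed (simp add: g_def)
  have g_out: "g i = 0" if "i \<notin> {1..n}" for i
    using that F1 by (cases i) (auto simp: g_def)
  have g_sum: "(\<Sum>j=1..i. g j) = F i" for i
    by (induction i) (simp_all add: F0 g_def)
  have tot: "(\<integral>\<^sup>+ x. ennreal (g x) \<partial>count_space UNIV) = 1"
  proof -
    have "(\<integral>\<^sup>+ x. ennreal (g x) \<partial>count_space UNIV) = (\<Sum>x\<in>{1..n}. ennreal (g x))"
      by (rule nn_integral_count_space') (use g_out in auto)
    also have "\<dots> = ennreal (\<Sum>x\<in>{1..n}. g x)" using g_nonneg by (simp add: sum_ennreal)
    also have "\<dots> = 1" unfolding g_sum using F1[of n] by simp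
    finally show ?thesis .
  qed
  define q where "q = embed_pmf g"
  have q: "pmf q i = g i" for i
    unfolding q_def by (rule pmf_embed_pmf) (use g_nonneg tot in auto)
  have step: "g (Suc (Suc k)) \<le> g (Suc k)" for k
  proof -
    obtain p where p: "p \<in> S" "F (Suc k) = P p (Suc k)" using F_att by blast
    have "pmf p (Suc (Suc k)) \<le> pmf p (Suc k)"
    proof (cases "Suc (Suc k) \<le> n")
      case True
      have "antimono_on {1..n} (pmf p)" using S(3)[OF p(1)] by (simp add: n_state_def)
      then show ?thesis by (rule monotone_onD) (use True in auto)
    next
      case False
      then show ?thesis using n_state_pmf_zero[OF S(3)[OF p(1)], of "Suc (Suc k)"] by simp
    qed
    moreover have "F k \<le> P p k" "F (Suc (Suc k)) \<le> P p (Suc (Suc k))" using p F_le by blast+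
    ultimately show ?thesis using p by (simp add: g_def P_Suc)
  qed
  have anti: "g j \<le> g i" if "1 \<le> i" "i \<le> j" for i j
    using that(2) that(1)
  proof (induction j rule: dec_induct)
    case (step m)
    then show ?case using \<open>\<And>k. g (Suc (Suc k)) \<le> g (Suc k)\<close>[of "m - 1"] by simp
  qed simp
  have "n_state n q"
    unfolding n_state_def
  proof
    show "set_pmf q \<subseteq> {1..n}" using g_out unfolding set_pmf_iff subset_iff q by blast
    show "antimono_on {1..n} (pmf q)" by (rule monotone_onI) (simp add: q anti)
  qed
  moreover have "(\<Sum>j=1..i. pmf q j) = (MIN p\<in>S. \<Sum>j=1..i. pmf p j)" for i
    using g_sum[of i] by (simp add: q F_def P_def)
  ultimately show ?thesis by blast
qed

lemma is_meet_meet: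
  assumes "mec_instance n S"
  shows "is_meet n S (meet n S)"
proof -
  obtain q where q: "is_meet n S q" using meet_exists[OF assms] is_meetI[OF assms] by blast
  then show ?thesis unfolding meet_def by (rule theI) (rule is_meet_unique[OF _ q])
qed

lemma sum_meet:
  assumes "mec_instance n S"
  shows "(\<Sum>j=1..i. pmf (meet n S) j) = (MIN p\<in>S. \<Sum>j=1..i. pmf p j)"
proof -
  obtain q where q: "n_state n q"
      "\<And>i. (\<Sum>j=1..i. pmf q j) = (MIN p\<in>S. \<Sum>j=1..i. pmf p j)"
    using meet_exists[OF assms] by blast
  then have "meet n S = q"
    using is_meet_unique[OF is_meet_meet[OF assms] is_meetI[OF assms]] by blast
  then show ?thesis using q(2) by simp
qed

end

theory Submission
  imports Defs
begin

text \<open>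
  Fix \<open>n\<close> and \<open>r = 1 - 1/n\<close>, and consider the \<open>n\<close>-state distributions whose states \<open>2, \<dots>, n\<close> all
  have probability \<open>r ^ k / n\<close>, for \<open>k = 0, \<dots>, K\<close>. The one with \<open>k = 0\<close> is uniform, so it is the
  meet. In a coupling \<open>C\<close>, every atom larger than \<open>r ^ k / n\<close> has to be mapped to state 1, so the
  atoms of size at most \<open>r ^ k / n\<close> have total mass at least \<open>r ^ (k + 1)\<close>. Summing this tail bound
  for the surprisal \<open>log 2 (1 / C x)\<close> over \<open>k\<close> shows that the entropy of \<open>C\<close> is, up to a factor
  tending to 1 in the excess, at least that of a geometric distribution with parameter \<open>1/n\<close>, which
  exceeds \<open>log 2 n\<close> by about \<open>log 2 e\<close>.
\<close>

section \<open>Spikes: masses, order and couplings\<close>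

definition spike :: "nat \<Rightarrow> real \<Rightarrow> nat pmf" where
  "spike n g = embed_pmf (\<lambda>j. if j = 1 then 1 - (real n - 1) * g else if j \<in> {1..n} then g else 0)"

context
  fixes n :: nat and g :: real
  assumes n: "n \<ge> 1" and g: "0 \<le> g" "g \<le> 1 / n"
begin

text \<open>The bound \<open>g \<le> 1 / n\<close> makes state 1 a most likely one, so the weights
  are both nonnegative and non-increasing.\<close>

lemma spike_top_ge: "g \<le> 1 - (real n - 1) * g"
  using n g by (simp add: field_simps)

lemma pmf_spike:
  "pmf (spike n g) j = (if j = 1 then 1 - (real n - 1) * g else if j \<in> {1..n} then g else 0)"
proof -
  let ?h = "\<lambda>j. if j = 1 then 1 - (real n - 1) * g else if j \<in> {1..n} then g else 0"
  have nonneg: "0 \<le> ?h j" for j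
    using spike_top_ge g by auto
  have "(\<integral>\<^sup>+ x. ennreal (?h x) \<partial>count_space UNIV) = (\<Sum>x\<in>{1..n}. ennreal (?h x))"
    by (rule nn_integral_count_space') (use n in auto)
  also have "\<dots> = ennreal (\<Sum>x\<in>{1..n}. ?h x)"
    using nonneg by (intro sum_ennreal)
  also have "(\<Sum>x\<in>{1..n}. ?h x) = ?h 1 + (\<Sum>x\<in>{Suc 1..n}. ?h x)"
    using n by (rule sum.atLeast_Suc_atMost)
  also have "\<dots> = 1"
    using n by (simp add: of_nat_diff)
  finally show ?thesis
    unfolding spike_def by (intro pmf_embed_pmf) (use nonneg in auto)
qed

lemma n_state_spike: "n_state n (spike n g)"
  unfolding n_state_def
proof
  show "set_pmf (spike n g) \<subseteq> {1..n}"
    using n by (auto simp: set_pmf_iff pmf_spike split: if_splits)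
  show "antimono_on {1..n} (pmf (spike n g))"
    by (rule monotone_onI) (use spike_top_ge in \<open>auto simp: pmf_spike\<close>)
qed

lemma sum_spike:
  assumes "1 \<le> i" "i \<le> n"
  shows "(\<Sum>j=1..i. pmf (spike n g) j) = 1 - (real n - real i) * g"
  using assms
  by (induction i rule: dec_induct) (auto simp: pmf_spike algebra_simps)

lemma prob_small_atoms_ge:
  assumes "map_pmf f C = spike n g"
  shows "(real n - 1) * g \<le> measure_pmf.prob C {x. pmf C x \<le> g}"
proof -
  \<comment> \<open>The fibre of \<open>f\<close> over \<open>f x\<close> contains
    \<open>x\<close>.\<close>
  have "pmf C x \<le> pmf (spike n g) (f x)" for x
    unfolding assms[symmetric] pmf_map
    by (subst pmf.rep_eq, intro measure_pmf.finite_measure_mono) auto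
  \<comment> \<open>Values \<open>f x\<close> outside \<open>{1..n}\<close> have mass 0 and are
    covered by \<open>g(1)\<close>.\<close>
  then have "pmf C x \<le> g" if "f x \<noteq> 1" for x
    using that g(1) by (metis order_trans pmf_spike)
  then have "- {x. pmf C x \<le> g} \<subseteq> f -` {1}"
    by auto
  then have "measure_pmf.prob C (- {x. pmf C x \<le> g}) \<le> measure_pmf.prob C (f -` {1})"
    by (intro measure_pmf.finite_measure_mono) auto
  also have "\<dots> = 1 - (real n - 1) * g"
    unfolding pmf_map[symmetric] assms by (simp add: pmf_spike)
  finally show ?thesis
    by (simp add: measure_pmf.prob_compl[of "{x. pmf C x \<le> g}" C, simplified] Compl_eq_Diff_UNIV)
qed

end

lemma pmf_uniform_spike:
  assumes "n \<ge> 1"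
  shows "pmf (spike n (1 / n)) j = (if j \<in> {1..n} then 1 / n else 0)"
  using assms by (auto simp: pmf_spike field_simps)

lemma pmf_le_of_map_uniform:
  assumes "map_pmf f C = spike n (1 / n)" "n \<ge> 1"
  shows "pmf C x \<le> 1 / n"
proof -
  have "pmf C x \<le> pmf (spike n (1 / n)) (f x)"
    unfolding assms(1)[symmetric] pmf_map
    by (subst pmf.rep_eq, intro measure_pmf.finite_measure_mono) auto
  also have "\<dots> \<le> 1 / n"
    using assms(2) by (simp add: pmf_uniform_spike)
  finally show ?thesis .
qed

text \<open>For \<open>1 \<le> i \<le> n\<close> a partial sum is 1 minus the mass of the last
  \<open>n - i\<close> states, and each of these has at most its uniform mass
  \<open>1 / n\<close>.\<close>

lemma uniform_majorized_spike:
  assumes "n \<ge> 1" "0 \<le> g" "g \<le> 1 / n"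
  shows "spike n (1 / n) \<preceq> spike n g"
  unfolding majorized_def
proof
  fix i
  consider "i = 0" | "1 \<le> i" "i \<le> n" | "n \<le> i" by linarith
  then show "(\<Sum>j=1..i. pmf (spike n (1 / n)) j) \<le> (\<Sum>j=1..i. pmf (spike n g) j)"
  proof cases
    case 2
    then have "(real n - real i) * g \<le> (real n - real i) * (1 / n)"
      using assms by (intro mult_left_mono) auto
    then show ?thesis
      using 2 assms by (simp add: sum_spike del: One_nat_def)
  next
    case 3
    then show ?thesis
      using assms sum_n_state[OF n_state_spike] by simp
  qed simp
qed

section \<open>Entropy of the uniform distribution and of couplings\<close>

lemma shannon_entropy_uniform:
  assumes "n \<ge> 1"
  shows "shannon_entropy (spike n (1 / n)) = ereal (log 2 n)"
proof -
  let ?p = "pmf (spike n (1 / n))"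
  have "(\<integral>\<^sup>+ x. ennreal (?p x * log 2 (1 / ?p x)) \<partial>count_space UNIV)
      = (\<Sum>x\<in>{1..n}. ennreal (?p x * log 2 (1 / ?p x)))"
    by (rule nn_integral_count_space') (use assms in \<open>auto simp: pmf_uniform_spike\<close>)
  also have "\<dots> = (\<Sum>x\<in>{1..n}. ennreal (log 2 n / n))"
    by (rule sum.cong) (use assms in \<open>auto simp: pmf_uniform_spike\<close>)
  also have "\<dots> = ennreal (\<Sum>x\<in>{1..n}. log 2 n / n)"
    using assms by (intro sum_ennreal) auto
  also have "(\<Sum>x\<in>{1..n}. log 2 n / n) = log 2 n"
    using assms by simp
  finally show ?thesis
    using assms by (simp add: shannon_entropy_def)
qed

text \<open>A discretized surprisal: each threshold \<open>r ^ Suc k / b\<close> that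
  \<open>x\<close> does not exceed contributes one unit \<open>log 2 (1 / r)\<close>. In expectation
  the indicators become tail probabilities.\<close>

lemma surprisal_ge_count:
  assumes x: "0 < x" "x \<le> 1 / b" and b: "0 < b" and r: "0 < r" "r < 1"
  shows "log 2 b + (\<Sum>k<K. log 2 (1 / r) * indicator {y. y \<le> r ^ Suc k / b} x) \<le> log 2 (1 / x)"
proof (induction K)
  case 0
  have "b \<le> 1 / x" using x b by (simp add: field_simps)
  then show ?case using b x by simp
next
  case (Suc K)
  show ?case
  \<comment> \<open>At or below the last threshold, counting all \<open>Suc K\<close> units is still
    affordable; above it, the new term vanishes.\<close>
  proof (cases "x \<le> r ^ Suc K / b")
    case True
    have L: "0 \<le> log 2 (1 / r)" using r by simp
    have "(\<Sum>k<Suc K. log 2 (1 / r) * indicator {y. y \<le> r ^ Suc k / b} x)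
        \<le> (\<Sum>k<Suc K. log 2 (1 / r))"
      by (rule sum_mono) (use L in \<open>auto simp: indicator_def\<close>)
    also have "\<dots> = log 2 ((1 / r) ^ Suc K)"
      using r by (subst log_nat_power) auto
    finally have "log 2 b + (\<Sum>k<Suc K. log 2 (1 / r) * indicator {y. y \<le> r ^ Suc k / b} x)
        \<le> log 2 b + log 2 ((1 / r) ^ Suc K)"
      by simp
    also have "\<dots> = log 2 (b * (1 / r) ^ Suc K)"
      using b r by (intro log_mult_pos[symmetric]) auto
    also have "\<dots> \<le> log 2 (1 / x)"
    proof -
      have "b * (1 / r) ^ Suc K \<le> 1 / x"
        using True x b r by (simp add: field_simps)
      then show ?thesis using b r x by simp
    qed
    finally show ?thesis .
  next
    case False
    then show ?thesis using Suc by simp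
  qed
qed

lemma shannon_entropy_coupling_ge:
  assumes n: "n \<ge> 2" and r: "r = 1 - 1 / real n"
    and C: "couples C ((\<lambda>k. spike n (r ^ k / n)) ` {..K})"
  shows "ereal (log 2 n + (\<Sum>k<K. log 2 (1 / r) * r ^ (k + 2))) \<le> shannon_entropy C"
proof -
  have r01: "0 < r" "r < 1" using n by (auto simp: r)
  have L: "0 \<le> log 2 (1 / r)" using r01 by simp
  \<comment> \<open>The thresholds start at exponent 1: exponent 0 is the bound \<open>1 / n\<close>
    on all atoms, already paid for by \<open>log 2 n\<close>.\<close>
  define A where "A k = {x. pmf C x \<le> r ^ Suc k / n}" for k
  have le: "pmf C x \<le> 1 / n" for x
  proof -
    have "spike n (r ^ 0 / n) \<in> (\<lambda>k. spike n (r ^ k / n)) ` {..K}"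
      by (rule imageI) simp
    then obtain f where "map_pmf f C = spike n (1 / n)"
      using C unfolding couples_def by fastforce
    then show ?thesis using n by (intro pmf_le_of_map_uniform) auto
  qed
  have A: "r ^ (k + 2) \<le> measure_pmf.prob C (A k)" if "k < K" for k
  proof -
    have "spike n (r ^ Suc k / n) \<in> (\<lambda>k. spike n (r ^ k / n)) ` {..K}"
      by (rule imageI) (use that in simp)
    then obtain f where "map_pmf f C = spike n (r ^ Suc k / n)"
      using C unfolding couples_def by blast
    then have "(real n - 1) * (r ^ Suc k / n) \<le> measure_pmf.prob C (A k)"
      unfolding A_def using n r01 power_le_one[of r "Suc k"]
      by (intro prob_small_atoms_ge) (auto intro!: divide_right_mono simp del: power_Suc)
    \<comment> \<open>The factor \<open>(n - 1) / n\<close> is \<open>r\<close> itself, which raises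
      the exponent to \<open>k + 2\<close>.\<close>
    moreover have "(real n - 1) * (r ^ Suc k / n) = r * r ^ Suc k"
      using n by (simp add: r field_simps)
    ultimately show ?thesis by simp
  qed
  \<comment> \<open>The estimate runs in \<open>ennreal\<close>, so infinite entropy needs no
    separate case.\<close>
  have "ennreal (log 2 n + (\<Sum>k<K. log 2 (1 / r) * r ^ (k + 2)))
      = ennreal (log 2 n) + (\<Sum>k<K. ennreal (log 2 (1 / r)) * ennreal (r ^ (k + 2)))"
    using n L r01
    by (simp add: ennreal_plus sum_nonneg flip: sum_ennreal ennreal_mult del: power_Suc add_2_eq_Suc')
  also have "\<dots> \<le> ennreal (log 2 n) + (\<Sum>k<K. ennreal (log 2 (1 / r)) * emeasure C (A k))"
    by (intro add_left_mono sum_mono mult_left_mono)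
       (use A in \<open>auto simp: measure_pmf.emeasure_eq_measure intro!: ennreal_leI\<close>)
  also have "\<dots> = (\<integral>\<^sup>+ x. (ennreal (log 2 n)
      + (\<Sum>k<K. ennreal (log 2 (1 / r)) * indicator (A k) x)) \<partial>measure_pmf C)"
    by (simp add: nn_integral_add nn_integral_sum nn_integral_cmult del: sum_mult_indicator sum_constant)
  also have "\<dots> \<le> (\<integral>\<^sup>+ x. ennreal (log 2 (1 / pmf C x)) \<partial>measure_pmf C)"
  proof (intro nn_integral_mono_AE AE_pmfI)
    \<comment> \<open>The comparison is confined to the support, since \<open>1 / pmf C x\<close> is
      only a default value at mass 0.\<close>
    fix x assume "x \<in> set_pmf C"
    then have "0 < pmf C x" by (rule pmf_positive)
    then have "log 2 n + (\<Sum>k<K. log 2 (1 / r) * indicator (A k) x) \<le> log 2 (1 / pmf C x)"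
      using surprisal_ge_count[of "pmf C x" "real n" r K] le n r01
      by (simp add: A_def indicator_def)
    moreover have "ennreal (log 2 n) + (\<Sum>k<K. ennreal (log 2 (1 / r)) * indicator (A k) x)
        = ennreal (log 2 n + (\<Sum>k<K. log 2 (1 / r) * indicator (A k) x))"
      using n L
      by (simp add: ennreal_plus sum_nonneg ennreal_mult ennreal_of_nat_eq_real_of_nat flip: sum_ennreal)
    ultimately show "ennreal (log 2 n) + (\<Sum>k<K. ennreal (log 2 (1 / r)) * indicator (A k) x)
        \<le> ennreal (log 2 (1 / pmf C x))"
      by (simp add: ennreal_leI)
  qed
  also have "\<dots> = (\<integral>\<^sup>+ x. ennreal (pmf C x * log 2 (1 / pmf C x)) \<partial>count_space UNIV)"
    unfolding nn_integral_measure_pmf by (simp add: ennreal_mult')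
  finally have "enn2ereal (ennreal (log 2 n + (\<Sum>k<K. log 2 (1 / r) * r ^ (k + 2))))
      \<le> shannon_entropy C"
    unfolding shannon_entropy_def by (simp only: less_eq_ennreal.rep_eq)
  moreover have "0 \<le> log 2 n + (\<Sum>k<K. log 2 (1 / r) * r ^ (k + 2))"
    using n L r01 by (intro add_nonneg_nonneg sum_nonneg mult_nonneg_nonneg) auto
  ultimately show ?thesis by (simp add: enn2ereal_ennreal)
qed

section \<open>Choice of \<open>n\<close> and \<open>K\<close>\<close>

lemma excess_exceeds:
  fixes c :: real
  assumes "c < log 2 (exp 1)"
  obtains n K :: nat and r :: real where "n \<ge> 2" "r = 1 - 1 / real n"
    "c < (\<Sum>k<K. log 2 (1 / r) * r ^ (k + 2))"
proof -
  \<comment> \<open>The full series over \<open>k\<close> equals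
    \<open>r\<^sup>2 * log 2 (1 / r) / (1 - r)\<close>, which is at least
    \<open>r\<^sup>2 * log 2 (exp 1)\<close>. As \<open>r\<close> tends to 1 with growing
    \<open>n\<close>, this lower bound eventually exceeds \<open>c\<close>, which fixes
    \<open>n\<close>.\<close>
  have "(\<lambda>n. (1 - 1 / real n)\<^sup>2 * log 2 (exp 1)) \<longlonglongrightarrow> (1 - 0)\<^sup>2 * log 2 (exp 1)"
    by (intro tendsto_intros lim_1_over_n)
  then have "eventually (\<lambda>n. c < (1 - 1 / real n)\<^sup>2 * log 2 (exp 1)) sequentially"
    using assms by (intro order_tendstoD) auto
  then obtain n where n: "n \<ge> 2" and c: "c < (1 - 1 / real n)\<^sup>2 * log 2 (exp 1)"
    using eventually_happens[OF eventually_conj[OF _ eventually_ge_at_top[of 2]]] by force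
  define r where "r = 1 - 1 / real n"
  have r: "0 < r" "r < 1" using n by (auto simp: r_def)
  have "log 2 (exp 1) \<le> log 2 (1 / r) / (1 - r)"
  proof -
    have "1 - r \<le> ln (1 / r)"
      using ln_le_minus_one[of r] r by (simp add: ln_div)
    then have "1 \<le> ln (1 / r) / (1 - r)"
      using r by simp
    then have "1 / ln 2 \<le> ln (1 / r) / (1 - r) / ln 2"
      by (intro divide_right_mono) auto
    then show ?thesis unfolding log_def by (simp only: ln_exp divide_divide_eq_left mult.commute)
  qed
  then have "r\<^sup>2 * log 2 (exp 1) \<le> r\<^sup>2 * (log 2 (1 / r) / (1 - r))"
    by (intro mult_left_mono) auto
  then have c': "c < log 2 (1 / r) * r\<^sup>2 * (1 / (1 - r))"
    using c unfolding r_def[symmetric] by (simp add: mult_ac)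
  \<comment> \<open>With \<open>n\<close> fixed, some partial sum of the geometric series already
    exceeds \<open>c\<close>; truncating at \<open>K\<close> keeps the set of spikes finite.\<close>
  have "(\<lambda>k. log 2 (1 / r) * r\<^sup>2 * r ^ k) sums (log 2 (1 / r) * r\<^sup>2 * (1 / (1 - r)))"
    using r by (intro sums_mult geometric_sums) auto
  then have "(\<lambda>K. \<Sum>k<K. log 2 (1 / r) * r ^ (k + 2)) \<longlonglongrightarrow> log 2 (1 / r) * r\<^sup>2 * (1 / (1 - r))"
    unfolding sums_def by (simp add: power_add mult_ac del: add_2_eq_Suc')
  then have "eventually (\<lambda>K. c < (\<Sum>k<K. log 2 (1 / r) * r ^ (k + 2))) sequentially"
    using c' by (rule order_tendstoD)
  then obtain K where "c < (\<Sum>k<K. log 2 (1 / r) * r ^ (k + 2))"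
    using eventually_happens[of _ sequentially] by auto
  then show ?thesis using that n r_def by blast
qed

theorem theorem4:
  fixes c :: real
  assumes "c < log 2 (exp 1)"
  shows "\<not> (\<exists>A :: nat \<Rightarrow> nat pmf set \<Rightarrow> nat pmf.
           (\<forall>n S. mec_instance n S \<longrightarrow> couples (A n S) S) \<and>
           (\<forall>n S. mec_instance n S \<longrightarrow>
              shannon_entropy (A n S) \<le> shannon_entropy (meet n S) + ereal c))"
proof
  assume "\<exists>A :: nat \<Rightarrow> nat pmf set \<Rightarrow> nat pmf.
           (\<forall>n S. mec_instance n S \<longrightarrow> couples (A n S) S) \<and>
           (\<forall>n S. mec_instance n S \<longrightarrow>
              shannon_entropy (A n S) \<le> shannon_entropy (meet n S) + ereal c)"
  then obtain A :: "nat \<Rightarrow> nat pmf set \<Rightarrow> nat pmf"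
    where A: "\<And>n S. mec_instance n S \<Longrightarrow> couples (A n S) S"
      "\<And>n S. mec_instance n S \<Longrightarrow>
        shannon_entropy (A n S) \<le> shannon_entropy (meet n S) + ereal c"
    by blast
  obtain n K :: nat and r :: real where n: "n \<ge> 2" and r: "r = 1 - 1 / real n"
    and c: "c < (\<Sum>k<K. log 2 (1 / r) * r ^ (k + 2))"
    using excess_exceeds[OF assms] .
  define S where "S = (\<lambda>k. spike n (r ^ k / n)) ` {..K}"
  have g: "0 \<le> r ^ k / n" "r ^ k / n \<le> 1 / n" for k
    using n power_le_one[of r k] by (auto simp: r intro!: divide_right_mono)
  have inst: "mec_instance n S"
    unfolding mec_instance_def S_def using n n_state_spike[OF _ g] by auto
  \<comment> \<open>The spike with \<open>k = 0\<close> is uniform. It lies in \<open>S\<close> and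
    is majorized by all of \<open>S\<close>, so it is the greatest lower bound.\<close>
  have "spike n (r ^ 0 / n) \<in> S"
    unfolding S_def by (rule imageI) simp
  then have "is_meet n S (spike n (1 / n))"
    unfolding is_meet_def
    using n uniform_majorized_spike[OF _ g] n_state_spike[of n "1 / n"] by (auto simp: S_def)
  then have "meet n S = spike n (1 / n)"
    using is_meet_unique is_meet_meet[OF inst] by blast
  then have "shannon_entropy (A n S) \<le> ereal (log 2 n + c)"
    using A(2)[OF inst] n shannon_entropy_uniform[of n] by simp
  moreover have "ereal (log 2 n + (\<Sum>k<K. log 2 (1 / r) * r ^ (k + 2))) \<le> shannon_entropy (A n S)"
    using A(1)[OF inst] n r unfolding S_def by (intro shannon_entropy_coupling_ge)
  ultimately have "ereal (log 2 n + (\<Sum>k<K. log 2 (1 / r) * r ^ (k + 2))) \<le> ereal (log 2 n + c)"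
    by (rule order_trans[rotated])
  then show False using c by simp
qed

end
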